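(* Let $p,q\ge 0$ be integers with $p+q\geq1$ and let $L_1,\dots,L_{p+q-1}$ be $C_2$-line bundles over $\mathbb P(\mathbb C^{p+q\sigma})$. For each $i$ let $s_i$ be an algebraic $C_2$-equivariant section of $L_i$ whose zero locus $H_i$ is a $C_2$-invariant hypersurface. Let $n_\dagger$ be the number of the $L_i$ of type $\dagger\in\{\mathrm I,\mathrm{II},\mathrm{III},\mathrm{IV}\}$ and put $$\alpha=n_{\mathrm I}+n_{\mathrm{II}}-(p-1),\qquad \beta=n_{\mathrm{II}}+n_{\mathrm{III}}-(q-1).$$ If the $p+q-1$ hypersurfaces $H_i$ are (nonequivariantly) dimensionally transverse, then $\alpha\ge0$ and $\beta\ge0$.
   Context: $C_2$ is the group of order $2$, $\mathbb C^\sigma$ its complex sign representation, $\mathbb C^{p+q\sigma}=\mathbb C^p\oplus(\mathbb C^\sigma)^q$, and $\mathbb P(\mathbb C^{p+q\sigma})$ is the space of complex lines with the induced $C_2$-action. $\omega$ is the tautological line bundle, $O(m)=(\omega^\vee)^{\otimes m}$ and $\chi O(m)=O(m)\otimes\mathbb C^\sigma$; every $C_2$-line bundle on $\mathbb P(\mathbb C^{p+q\sigma})$ is of one of these forms. Types: I is $O(m)$ with $m$ odd; II is $O(m)$ with $m$ even; III is $\chi O(m)$ with $m$ odd; IV is $\chi O(m)$ with $m$ even. Nonequivariantly dimensionally transverse means that the intersection $\bigcap_iH_i$ has the expected codimension, i.e. (since there are $p+q-1=\dim_{\mathbb C}\mathbb P(\mathbb C^{p+q\sigma})$ hypersurfaces)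 it is a discrete set of points. *)

theory Defs
  imports "HOL-Analysis.Analysis"
begin

section \<open>The representation and its projective space\<close>

text \<open>
  Vectors are functions on \<open>nat\<close> supported on \<open>{..<p + q}\<close>; the coordinates below \<open>p\<close>
  are the trivial summands and the next \<open>q\<close> coordinates are the sign summands.
\<close>

definition zerov :: "nat \<Rightarrow> complex" where
  "zerov = (\<lambda>_. 0)"

definition sigma_rep :: "nat \<Rightarrow> nat \<Rightarrow> (nat \<Rightarrow> complex) set" where
  "sigma_rep p q = {v. \<forall>i\<ge>p + q. v i = 0}"

text \<open>The generator of \<open>C\<^sub>2\<close>. All actions below are given by the generator, which is its own inverse.\<close>

definition act :: "nat \<Rightarrow> (nat \<Rightarrow> complex) \<Rightarrow> (nat \<Rightarrow> complex)" where
  "act p v = (\<lambda>i. if i < p then v i else - v i)"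

definition complex_line :: "(nat \<Rightarrow> complex) \<Rightarrow> (nat \<Rightarrow> complex) set" where
  "complex_line v = range (\<lambda>c i. c * v i)"

definition proj_space :: "nat \<Rightarrow> nat \<Rightarrow> (nat \<Rightarrow> complex) set set" where
  "proj_space p q = complex_line ` (sigma_rep p q - {zerov})"

definition proj_topology :: "nat \<Rightarrow> nat \<Rightarrow> (nat \<Rightarrow> complex) set topology" where
  "proj_topology p q = topology (\<lambda>U. U \<subseteq> proj_space p q \<and>
     openin (top_of_set (sigma_rep p q - {zerov})) {v \<in> sigma_rep p q - {zerov}. complex_line v \<in> U})"

lemma openin_proj_topology:
  "openin (proj_topology p q) U \<longleftrightarrow> U \<subseteq> proj_space p q \<and>
     openin (top_of_set (sigma_rep p q - {zerov})) {v \<in> sigma_rep p q - {zerov}. complex_line v \<in> U}"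
proof -
  let ?X = "top_of_set (sigma_rep p q - {zerov})"
  let ?pre = "\<lambda>U. {v \<in> sigma_rep p q - {zerov}. complex_line v \<in> U}"
  have ist: "istopology (\<lambda>U. U \<subseteq> proj_space p q \<and> openin ?X (?pre U))"
    unfolding istopology_def
  proof (intro conjI allI impI)
    fix S T
    assume S: "S \<subseteq> proj_space p q \<and> openin ?X (?pre S)" and T: "T \<subseteq> proj_space p q \<and> openin ?X (?pre T)"
    show "S \<inter> T \<subseteq> proj_space p q" using S by blast
    have "?pre (S \<inter> T) = ?pre S \<inter> ?pre T" by blast
    then show "openin ?X (?pre (S \<inter> T))" using S T openin_Int[of ?X "?pre S" "?pre T"] by (simp only:)
  next
    fix K
    assume K: "\<forall>S\<in>K. S \<subseteq> proj_space p q \<and> openin ?X (?pre S)"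
    show "\<Union>K \<subseteq> proj_space p q" using K by (simp add: Union_least)
    have "?pre (\<Union>K) = \<Union>(?pre ` K)" by blast
    moreover have "openin ?X (\<Union>(?pre ` K))"
      using K by (intro openin_Union) blast
    ultimately show "openin ?X (?pre (\<Union>K))" by simp
  qed
  show ?thesis
    unfolding proj_topology_def topology_inverse'[OF ist] by (rule refl)
qed

lemma quotient_map_line:
  "quotient_map (top_of_set (sigma_rep p q - {zerov})) (proj_topology p q) complex_line"
proof -
  have pre: "{v \<in> sigma_rep p q - {zerov}. complex_line v \<in> proj_space p q} = sigma_rep p q - {zerov}"
    by (auto simp: proj_space_def)
  have "openin (proj_topology p q) (proj_space p q)"
    unfolding openin_proj_topology pre by (simp add: openin_subtopology_self)
  moreover have "topspace (proj_topology p q) \<subseteq> proj_space p q"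
    using openin_topspace[of "proj_topology p q"] unfolding openin_proj_topology by (rule conjunct1)
  ultimately have top: "topspace (proj_topology p q) = proj_space p q"
    by (intro subset_antisym openin_subset)
  show ?thesis
    unfolding quotient_map_def top openin_proj_topology by (auto simp: proj_space_def)
qed

section \<open>Polynomials and hypersurfaces\<close>

definition exponents :: "nat \<Rightarrow> nat \<Rightarrow> (nat \<Rightarrow> nat) set" where
  "exponents n d = {a. (\<forall>i\<ge>n. a i = 0) \<and> (\<Sum>i<n. a i) = d}"

lemma finite_exponents: "finite (exponents n d)"
proof (rule finite_subset)
  show "exponents n d \<subseteq> (\<lambda>g i. if i < n then g i else 0) ` ({..<n} \<rightarrow>\<^sub>E {..d})"
  proof
    fix a assume a: "a \<in> exponents n d"
    have "a i \<le> d" if "i < n" for i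
    proof -
      have "a i \<le> sum a {..<n}" by (rule member_le_sum) (use that in simp_all)
      then show ?thesis using a by (simp add: exponents_def)
    qed
    then have r: "restrict a {..<n} \<in> {..<n} \<rightarrow>\<^sub>E {..d}" by (simp add: restrict_PiE_iff)
    have "a = (\<lambda>i. if i < n then restrict a {..<n} i else 0)"
      using a by (simp add: exponents_def fun_eq_iff)
    with r show "a \<in> (\<lambda>g i. if i < n then g i else 0) ` ({..<n} \<rightarrow>\<^sub>E {..d})" by (intro image_eqI)
  qed
  show "finite ((\<lambda>g i. if i < n then g i else 0 :: nat) ` ({..<n} \<rightarrow>\<^sub>E {..d}))"
    by (intro finite_imageI finite_PiE) simp_all
qed

text \<open>Since \<open>\<complex>\<close> is infinite, polynomials are identified with polynomial functions.\<close>

definition homogeneous_poly :: "nat \<Rightarrow> nat \<Rightarrow> ((nat \<Rightarrow> complex) \<Rightarrow> complex) \<Rightarrow> bool" where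
  "homogeneous_poly n d f \<longleftrightarrow>
     (\<exists>c :: (nat \<Rightarrow> nat) \<Rightarrow> complex. f = (\<lambda>v. \<Sum>a\<in>exponents n d. c a * (\<Prod>i<n. v i ^ a i)))"

definition hypersurface :: "nat \<Rightarrow> nat \<Rightarrow> (nat \<Rightarrow> complex) set set \<Rightarrow> bool" where
  "hypersurface p q H \<longleftrightarrow>
     (\<exists>d f. d \<ge> 1 \<and> homogeneous_poly (p + q) d f \<and> f \<noteq> (\<lambda>_. 0) \<and>
        H = {l \<in> proj_space p q. \<forall>v\<in>l. f v = 0})"

definition act_invariant :: "nat \<Rightarrow> (nat \<Rightarrow> complex) set set \<Rightarrow> bool" where
  "act_invariant p H \<longleftrightarrow> (\<lambda>l. act p ` l) ` H = H"

section \<open>Equivariant line bundles and their sections\<close>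

text \<open>\<open>Oline m\<close> is \<open>O(m)\<close> and \<open>ChiOline m\<close> is \<open>\<chi>O(m)\<close>; these are all the \<open>C\<^sub>2\<close>-line bundles.\<close>

datatype line_bundle = Oline int | ChiOline int

fun line_degree :: "line_bundle \<Rightarrow> int" where
  "line_degree (Oline m) = m"
| "line_degree (ChiOline m) = m"

fun line_sign :: "line_bundle \<Rightarrow> complex" where
  "line_sign (Oline m) = 1"
| "line_sign (ChiOline m) = - 1"

text \<open>
  The fibre of the tautological bundle at the line \<open>l\<close> is \<open>l\<close> itself, so the fibre of \<open>O(m)\<close> is
  the \<open>m\<close>-th tensor power of the dual of \<open>l\<close>. It is realised, for \<open>m\<close> of either sign, as the
  functions on \<open>l - {0}\<close> that are homogeneous of degree \<open>m\<close>, extended by zero. The fibre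
  of \<open>\<chi>O(m)\<close> is the same vector space; only the action on the bundle changes by a sign.
\<close>

definition fibre :: "line_bundle \<Rightarrow> (nat \<Rightarrow> complex) set \<Rightarrow> ((nat \<Rightarrow> complex) \<Rightarrow> complex) set" where
  "fibre L l = {\<phi>.
     (\<forall>v\<in>l - {zerov}. \<forall>c. c \<noteq> 0 \<longrightarrow> \<phi> (\<lambda>i. c * v i) = c powi line_degree L * \<phi> v) \<and>
     (\<forall>v. v \<notin> l - {zerov} \<longrightarrow> \<phi> v = 0)}"

text \<open>The generator maps the fibre at \<open>l\<close> to the fibre at \<open>act p ` l\<close>, by precomposing with its inverse.\<close>

definition bundle_act ::
  "nat \<Rightarrow> line_bundle \<Rightarrow> ((nat \<Rightarrow> complex) \<Rightarrow> complex) \<Rightarrow> ((nat \<Rightarrow> complex) \<Rightarrow> complex)" where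
  "bundle_act p L \<phi> = (\<lambda>v. line_sign L * \<phi> (act p v))"

lemma act_act [simp]: "act p (act p v) = v"
  by (auto simp: act_def)

lemma bundle_act_fibre:
  assumes "\<phi> \<in> fibre L l"
  shows "bundle_act p L \<phi> \<in> fibre L (act p ` l)"
proof -
  have z0: "act p zerov = zerov"
    by (auto simp: act_def zerov_def)
  have z: "act p v = zerov \<longleftrightarrow> v = zerov" for v
    using z0 act_act by metis
  have im: "v \<in> act p ` l \<longleftrightarrow> act p v \<in> l" for v
    by (metis act_act image_iff)
  have sc: "act p (\<lambda>i. c * v i) = (\<lambda>i. c * act p v i)" for c v
    by (simp add: act_def fun_eq_iff)
  show ?thesis
    using assms by (simp add: fibre_def bundle_act_def z im sc)
qed

text \<open>
  A section assigns to each line a point of the fibre over it. It is algebraic if near each line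
  it is a quotient of homogeneous polynomials whose degrees differ by the degree of the bundle.
\<close>

type_synonym bundle_section = "(nat \<Rightarrow> complex) set \<Rightarrow> (nat \<Rightarrow> complex) \<Rightarrow> complex"

definition algebraic_section :: "nat \<Rightarrow> nat \<Rightarrow> line_bundle \<Rightarrow> bundle_section \<Rightarrow> bool" where
  "algebraic_section p q L s \<longleftrightarrow>
     (\<forall>l\<in>proj_space p q. s l \<in> fibre L l) \<and>
     (\<forall>k\<in>proj_space p q. \<exists>d e f g.
        homogeneous_poly (p + q) d f \<and> homogeneous_poly (p + q) e g \<and> int d = int e + line_degree L \<and>
        (\<forall>v\<in>k - {zerov}. g v \<noteq> 0) \<and>
        (\<forall>l\<in>proj_space p q. \<forall>v\<in>l - {zerov}. g v \<noteq> 0 \<longrightarrow> s l v = f v / g v))"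

definition equivariant_section :: "nat \<Rightarrow> nat \<Rightarrow> line_bundle \<Rightarrow> bundle_section \<Rightarrow> bool" where
  "equivariant_section p q L s \<longleftrightarrow> (\<forall>l\<in>proj_space p q. s (act p ` l) = bundle_act p L (s l))"

definition zero_locus :: "nat \<Rightarrow> nat \<Rightarrow> bundle_section \<Rightarrow> (nat \<Rightarrow> complex) set set" where
  "zero_locus p q s = {l \<in> proj_space p q. s l = (\<lambda>_. 0)}"

text \<open>
  For \<open>p + q - 1\<close> hypersurfaces the expected dimension of the intersection is zero. The
  intersection is taken inside projective space, which matters when there are no hypersurfaces.
\<close>

definition dimensionally_transverse :: "nat \<Rightarrow> nat \<Rightarrow> (nat \<Rightarrow> (nat \<Rightarrow> complex) set set) \<Rightarrow> bool" where
  "dimensionally_transverse p q H \<longleftrightarrow>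
     (let X = proj_space p q \<inter> (\<Inter>i<p + q - 1. H i)
      in subtopology (proj_topology p q) X = discrete_topology X)"

section \<open>Types of line bundles\<close>

datatype bundle_type = TypeI | TypeII | TypeIII | TypeIV

fun bundle_type_of :: "line_bundle \<Rightarrow> bundle_type" where
  "bundle_type_of (Oline m) = (if odd m then TypeI else TypeII)"
| "bundle_type_of (ChiOline m) = (if odd m then TypeIII else TypeIV)"

definition num_type :: "nat \<Rightarrow> nat \<Rightarrow> (nat \<Rightarrow> line_bundle) \<Rightarrow> bundle_type \<Rightarrow> nat" where
  "num_type p q L t = card {i. i < p + q - 1 \<and> bundle_type_of (L i) = t}"

definition alpha :: "nat \<Rightarrow> nat \<Rightarrow> (nat \<Rightarrow> line_bundle) \<Rightarrow> int" where
  "alpha p q L = int (num_type p q L TypeI) + int (num_type p q L TypeII) - (int p - 1)"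

definition beta :: "nat \<Rightarrow> nat \<Rightarrow> (nat \<Rightarrow> line_bundle) \<Rightarrow> int" where
  "beta p q L = int (num_type p q L TypeII) + int (num_type p q L TypeIII) - (int q - 1)"

end

theory Submission
  imports Defs "HOL-Complex_Analysis.Conformal_Mappings"
begin

text \<open>
  Sections of type III and IV vanish on the component \<open>\<P>(\<complex>\<^sup>p)\<close> of the fixed point set, and those of
  type I and IV on \<open>\<P>(\<complex>\<^bsup>q\<sigma>\<^esup>)\<close>. If \<open>\<alpha> < 0\<close> or \<open>\<beta> < 0\<close>, then fewer forms than the dimension of
  that component remain, and they cannot have a discrete set of common zeros there: by compactness it
  would be finite, so a hyperplane would miss it, yet fewer than \<open>n\<close> forms on \<open>\<complex>\<^sup>n\<close>
  always have a common nontrivial zero.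

  For the last fact suppose that \<open>f\<^sub>1, \<dots>, f\<^sub>k\<close>, with \<open>k < n\<close>, only vanish together at 0. Then
  \<open>\<psi>(x) = |x|\<^sup>2 - \<Sum>\<^sub>j |f\<^sub>j(x)\<^sup>2|\<^sup>2\<close> tends to \<open>-\<infinity>\<close>, so it has a global maximum \<open>x\<close>. But along a nonzero \<open>v\<close>
  in the kernel of the derivative of \<open>(f\<^sub>j\<^sup>2)\<^sub>j\<close> at \<open>x\<close>, the function \<open>\<psi>(x + tv)\<close> is up to terms of
  order \<open>|t|\<^sup>4\<close> the sum of a harmonic function of \<open>t\<close> and \<open>|t|\<^sup>2|v|\<^sup>2\<close>, which contradicts the maximum principle.
\<close>

section \<open>Underdetermined systems of forms\<close>

text \<open>Gaussian elimination, by induction on the equations: one with a nonzero coefficient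
  removes itself together with one unknown, and a zero equation is simply dropped, so equations stay
  fewer than unknowns.\<close>

lemma underdetermined_linear_system:
  fixes A :: "'j \<Rightarrow> 'i \<Rightarrow> 'a::field"
  assumes "finite J" "finite I" "card J < card I"
  shows "\<exists>v. (\<forall>i. i \<notin> I \<longrightarrow> v i = 0) \<and> (\<exists>i. v i \<noteq> 0) \<and> (\<forall>j\<in>J. (\<Sum>i\<in>I. A j i * v i) = 0)"
  using assms
proof (induction J arbitrary: I A rule: finite_induct)
  case empty
  then obtain i where "i \<in> I" by fastforce
  then show ?case by (intro exI[of _ "\<lambda>k. if k = i then 1 else 0"]) auto
next
  case (insert j J)
  show ?case
  proof (cases "\<forall>i\<in>I. A j i = 0")
    case True
    have "card J < card I" using insert by simp
    from insert.IH[OF insert.prems(1) this, of A] obtain v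
      where "\<forall>i. i \<notin> I \<longrightarrow> v i = 0" "\<exists>i. v i \<noteq> 0" "\<forall>j\<in>J. (\<Sum>i\<in>I. A j i * v i) = 0" by blast
    with True show ?thesis by (intro exI[of _ v]) auto
  next
    case False
    then obtain k where k: "k \<in> I" "A j k \<noteq> 0" by blast
    define I' where "I' = I - {k}"
    have I': "finite I'" "card J < card I'" "k \<notin> I'" "I = insert k I'"
      using insert k by (auto simp: I'_def)
    \<comment> \<open>\<open>B\<close> is the matrix after clearing column \<open>k\<close> with the
      pivot row \<open>j\<close>; the pivot row itself becomes zero.\<close>
    define B where "B j' i = A j' i - A j' k * A j i / A j k" for j' i
    from insert.IH[OF I'(1,2), of B] obtain w
      where w: "\<forall>i. i \<notin> I' \<longrightarrow> w i = 0" "\<exists>i. w i \<noteq> 0" "\<forall>j\<in>J. (\<Sum>i\<in>I'. B j i * w i) = 0" by blast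
    \<comment> \<open>Back substitution: the entry at \<open>k\<close> is the one that solves
      equation \<open>j\<close>.\<close>
    define v where "v = w(k := - (\<Sum>i\<in>I'. A j i * w i) / A j k)"
    have sum_v: "(\<Sum>i\<in>I. A j' i * v i) = (\<Sum>i\<in>I'. B j' i * w i)" for j'
    proof -
      have "(\<Sum>i\<in>I'. A j' i * v i) = (\<Sum>i\<in>I'. A j' i * w i)"
        by (rule sum.cong) (use I' in \<open>auto simp: v_def\<close>)
      then have "(\<Sum>i\<in>I. A j' i * v i)
          = (\<Sum>i\<in>I'. A j' i * w i) - A j' k / A j k * (\<Sum>i\<in>I'. A j i * w i)"
        using I' by (simp add: v_def)
      also have "\<dots> = (\<Sum>i\<in>I'. B j' i * w i)"
        by (simp add: B_def sum_distrib_left left_diff_distrib sum_subtractf mult.assoc)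
      finally show ?thesis .
    qed
    have "(\<Sum>i\<in>I. A j' i * v i) = 0" if "j' \<in> insert j J" for j'
      using that w(3) k(2) unfolding sum_v by (auto simp: B_def)
    moreover have "v i = 0" if "i \<notin> I" for i
      using that w(1) I' by (auto simp: v_def)
    moreover have "\<exists>i. v i \<noteq> 0"
      using w(1,2) I'(3) by (metis fun_upd_other v_def)
    ultimately show ?thesis by blast
  qed
qed

section \<open>Polynomial functions, and a maximum principle in one variable\<close>

inductive polyfun :: "(('i \<Rightarrow> complex) \<Rightarrow> complex) \<Rightarrow> bool" where
  const: "polyfun (\<lambda>_. c)"
| coord: "polyfun (\<lambda>v. v i)"
| add: "polyfun f \<Longrightarrow> polyfun g \<Longrightarrow> polyfun (\<lambda>v. f v + g v)"
| mult: "polyfun f \<Longrightarrow> polyfun g \<Longrightarrow> polyfun (\<lambda>v. f v * g v)"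

lemma polyfun_sum: "(\<And>a. a \<in> S \<Longrightarrow> polyfun (f a)) \<Longrightarrow> polyfun (\<lambda>v. \<Sum>a\<in>S. f a v)"
  by (induction S rule: infinite_finite_induct) (auto intro: polyfun.intros)

lemma polyfun_prod: "(\<And>a. a \<in> S \<Longrightarrow> polyfun (f a)) \<Longrightarrow> polyfun (\<lambda>v. \<Prod>a\<in>S. f a v)"
  by (induction S rule: infinite_finite_induct) (auto intro: polyfun.intros)

lemma polyfun_power: "polyfun f \<Longrightarrow> polyfun (\<lambda>v. f v ^ n)"
  by (induction n) (auto intro: polyfun.intros)

lemma polyfun_continuous: "polyfun f \<Longrightarrow> continuous_on UNIV f"
  by (induction rule: polyfun.induct)
     (auto intro: continuous_intros continuous_on_product_coordinates)

lemma polyfun_line_holomorphic: "polyfun f \<Longrightarrow> (\<lambda>t. f (\<lambda>i. x i + t * v i)) holomorphic_on S"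
  by (induction rule: polyfun.induct) (auto intro!: holomorphic_intros)

text \<open>The coefficients \<open>A\<close> are fixed before the direction \<open>v\<close>, so
  requiring the derivatives of several polynomials at \<open>x\<close> to vanish along
  \<open>v\<close> is a linear system in \<open>v\<close>.\<close>

lemma polyfun_gradient:
  assumes "polyfun f"
  obtains A where "\<And>I v. finite I \<Longrightarrow> (\<And>i. i \<notin> I \<Longrightarrow> v i = 0) \<Longrightarrow>
    ((\<lambda>t. f (\<lambda>i. x i + t * v i)) has_field_derivative (\<Sum>i\<in>I. A i * v i)) (at 0)"
proof -
  have "\<exists>A. \<forall>I v. finite I \<longrightarrow> (\<forall>i. i \<notin> I \<longrightarrow> v i = 0) \<longrightarrow>
    ((\<lambda>t. f (\<lambda>i. x i + t * v i)) has_field_derivative (\<Sum>i\<in>I. A i * v i)) (at 0)"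
    using assms
  proof (induction rule: polyfun.induct)
    case (const c)
    show ?case by (rule exI[of _ "\<lambda>_. 0"]) simp
  next
    case (coord k)
    have "(\<Sum>i\<in>I. (if i = k then 1 else 0) * v i) = v k"
      if "finite I" "\<forall>i. i \<notin> I \<longrightarrow> v i = 0" for I and v :: "'a \<Rightarrow> complex"
      using that by (simp add: if_distrib[of "\<lambda>c. c * _"] cong: if_cong)
    then show ?case
      by (intro exI[of _ "\<lambda>i. if i = k then 1 else 0"]) (auto intro!: derivative_eq_intros)
  next
    case (add f g)
    then obtain A B where
      "\<forall>I v. finite I \<longrightarrow> (\<forall>i. i \<notin> I \<longrightarrow> v i = 0) \<longrightarrow>
        ((\<lambda>t. f (\<lambda>i. x i + t * v i)) has_field_derivative (\<Sum>i\<in>I. A i * v i)) (at 0)"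
      "\<forall>I v. finite I \<longrightarrow> (\<forall>i. i \<notin> I \<longrightarrow> v i = 0) \<longrightarrow>
        ((\<lambda>t. g (\<lambda>i. x i + t * v i)) has_field_derivative (\<Sum>i\<in>I. B i * v i)) (at 0)"
      by blast
    then show ?case
      by (intro exI[of _ "\<lambda>i. A i + B i"])
         (auto simp: distrib_right sum.distrib intro!: DERIV_add)
  next
    case (mult f g)
    then obtain A B where
      AB: "\<forall>I v. finite I \<longrightarrow> (\<forall>i. i \<notin> I \<longrightarrow> v i = 0) \<longrightarrow>
        ((\<lambda>t. f (\<lambda>i. x i + t * v i)) has_field_derivative (\<Sum>i\<in>I. A i * v i)) (at 0)"
      "\<forall>I v. finite I \<longrightarrow> (\<forall>i. i \<notin> I \<longrightarrow> v i = 0) \<longrightarrow>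
        ((\<lambda>t. g (\<lambda>i. x i + t * v i)) has_field_derivative (\<Sum>i\<in>I. B i * v i)) (at 0)"
      by blast
    have "((\<lambda>t. f (\<lambda>i. x i + t * v i) * g (\<lambda>i. x i + t * v i)) has_field_derivative
        (\<Sum>i\<in>I. (A i * g x + B i * f x) * v i)) (at 0)"
      if "finite I" "\<forall>i. i \<notin> I \<longrightarrow> v i = 0" for I v
    proof -
      have "((\<lambda>t. f (\<lambda>i. x i + t * v i) * g (\<lambda>i. x i + t * v i)) has_field_derivative
        (\<Sum>i\<in>I. A i * v i) * g (\<lambda>i. x i + 0 * v i) + (\<Sum>i\<in>I. B i * v i) * f (\<lambda>i. x i + 0 * v i)) (at 0)"
        by (rule DERIV_mult) (use AB that in blast)+
      moreover have "(\<Sum>i\<in>I. (A i * g x + B i * f x) * v i)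
          = (\<Sum>i\<in>I. A i * v i) * g x + (\<Sum>i\<in>I. B i * v i) * f x"
        unfolding sum_distrib_right sum.distrib[symmetric] by (rule sum.cong) (auto simp: algebra_simps)
      ultimately show ?thesis by simp
    qed
    then show ?case by (intro exI[of _ "\<lambda>i. A i * g x + B i * f x"]) simp
  qed
  then show ?thesis using that by blast
qed

text \<open>Each \<open>\<delta> j\<close> vanishes to first order, so near 0 half of the term
  \<open>a * (cmod t)\<^sup>2\<close> absorbs the subtracted sum. Without an increase,
  \<open>Re (h t)\<close> would then drop strictly away from 0, which a harmonic function cannot
  do.\<close>

lemma second_order_increase:
  fixes h :: "complex \<Rightarrow> complex" and \<delta> :: "'j \<Rightarrow> complex \<Rightarrow> complex"
  assumes "finite J" and h: "h holomorphic_on UNIV" and "a > 0"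
    and \<delta>0: "\<And>j. j \<in> J \<Longrightarrow> \<delta> j 0 = 0"
    and \<delta>': "\<And>j. j \<in> J \<Longrightarrow> (\<delta> j has_field_derivative 0) (at 0)"
  shows "\<exists>t. 2 * Re (h t) + a * (cmod t)\<^sup>2 - (\<Sum>j\<in>J. (cmod (\<delta> j t))\<^sup>2) > 2 * Re (h 0)"
proof (rule ccontr)
  assume "\<not> ?thesis"
  then have le: "2 * Re (h t) + a * (cmod t)\<^sup>2 - (\<Sum>j\<in>J. (cmod (\<delta> j t))\<^sup>2) \<le> 2 * Re (h 0)" for t
    by (simp add: not_less)
  have "((\<lambda>t. \<Sum>j\<in>J. (cmod (\<delta> j t / t))\<^sup>2) \<longlongrightarrow> (\<Sum>j\<in>J. (cmod 0)\<^sup>2)) (at 0)"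
  proof (intro tendsto_intros)
    fix j assume j: "j \<in> J"
    show "((\<lambda>t. \<delta> j t / t) \<longlongrightarrow> 0) (at 0)"
      using \<delta>'[OF j] \<delta>0[OF j] by (simp add: has_field_derivative_iff)
  qed
  then have "((\<lambda>t. \<Sum>j\<in>J. (cmod (\<delta> j t / t))\<^sup>2) \<longlongrightarrow> 0) (at 0)" by simp
  from order_tendstoD(2)[OF this, of "a / 2"] \<open>a > 0\<close>
  obtain r where "r > 0" and r: "\<And>t. t \<noteq> 0 \<Longrightarrow> dist t 0 < r \<Longrightarrow> (\<Sum>j\<in>J. (cmod (\<delta> j t / t))\<^sup>2) < a / 2"
    unfolding eventually_at by auto
  have Re_le: "2 * Re (h t) + a / 2 * (cmod t)\<^sup>2 \<le> 2 * Re (h 0)" if "cmod t < r" for t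
  proof (cases "t = 0")
    case False
    have "(\<Sum>j\<in>J. (cmod (\<delta> j t))\<^sup>2) = (\<Sum>j\<in>J. (cmod (\<delta> j t / t))\<^sup>2) * (cmod t)\<^sup>2"
      using False by (simp add: sum_distrib_right norm_divide power_divide)
    also have "\<dots> \<le> a / 2 * (cmod t)\<^sup>2"
      using r[OF False] that by (intro mult_right_mono) auto
    finally show ?thesis using le[of t] by simp
  qed simp
  \<comment> \<open>The modulus of \<open>exp (h t)\<close> is the exponential of
    \<open>Re (h t)\<close>, so the maximum modulus principle makes a local maximum of
    \<open>Re (h t)\<close> at 0 force constancy.\<close>
  have "(\<lambda>t. exp (h t)) constant_on UNIV"
  proof (rule maximum_modulus_principle)
    show "norm (exp (h z)) \<le> norm (exp (h 0))" if "z \<in> ball 0 r" for z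
    proof -
      have "0 \<le> a / 2 * (cmod z)\<^sup>2" using \<open>a > 0\<close> by simp
      then show ?thesis using Re_le[of z] that by (simp add: norm_exp_eq_Re)
    qed
  qed (use h \<open>r > 0\<close> in \<open>auto intro: holomorphic_intros\<close>)
  \<comment> \<open>Any nonzero point of the ball would do; at \<open>r / 2\<close> constancy
    contradicts the strict drop in \<open>Re_le\<close>.\<close>
  then have "exp (h (of_real (r / 2))) = exp (h 0)"
    by (metis UNIV_I constant_on_def)
  then have "cmod (exp (h (of_real (r / 2)))) = cmod (exp (h 0))" by simp
  then have "Re (h (of_real (r / 2))) = Re (h 0)" by (simp only: norm_exp_eq_Re exp_inj_iff)
  moreover have "cmod (of_real (r / 2)) = r / 2" using \<open>r > 0\<close> by (simp only: norm_of_real)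
  ultimately have "a / 2 * (r / 2)\<^sup>2 \<le> 0" using Re_le[of "of_real (r / 2)"] \<open>r > 0\<close> by simp
  then show False using \<open>a > 0\<close> \<open>r > 0\<close> by (simp add: mult_le_0_iff)
qed

section \<open>Norms and compactness on coordinate subspaces\<close>

definition supp_space :: "'i set \<Rightarrow> ('i \<Rightarrow> complex) set" where
  "supp_space I = {v. \<forall>i. i \<notin> I \<longrightarrow> v i = 0}"

definition sqnorm :: "'i set \<Rightarrow> ('i \<Rightarrow> complex) \<Rightarrow> real" where
  "sqnorm I v = (\<Sum>i\<in>I. (cmod (v i))\<^sup>2)"

lemma sqnorm_pos:
  assumes "finite I" "v \<in> supp_space I" "v i \<noteq> 0"
  shows "sqnorm I v > 0"
proof -
  have "i \<in> I" using assms by (auto simp: supp_space_def)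
  then show ?thesis using assms unfolding sqnorm_def by (intro sum_pos2[of I i]) auto
qed

lemma sqnorm_scale: "sqnorm I (\<lambda>i. c * v i) = (cmod c)\<^sup>2 * sqnorm I v"
  by (simp add: sqnorm_def norm_mult power_mult_distrib sum_distrib_left)

lemma supp_space_scale: "v \<in> supp_space I \<Longrightarrow> (\<lambda>i. c * v i) \<in> supp_space I"
  by (simp add: supp_space_def)

lemma continuous_on_sqnorm: "continuous_on S (sqnorm I)"
proof -
  have "continuous_on UNIV (\<lambda>v. \<Sum>i\<in>I. (cmod (v i))\<^sup>2)"
    by (intro continuous_intros continuous_on_product_coordinates)
  then show ?thesis
    unfolding sqnorm_def[abs_def] by (rule continuous_on_subset) simp
qed

text \<open>The ball is a closed subset of a product of discs over \<open>I\<close> and of points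
  \<open>{0}\<close> elsewhere, which is compact by Tychonoff's theorem even when the index type is
  infinite.\<close>

lemma compact_sqnorm_ball:
  assumes "finite I"
  shows "compact {v \<in> supp_space I. sqnorm I v \<le> R}"
proof -
  define B where "B i = (if i \<in> I then cball (0::complex) (sqrt R) else {0})" for i :: 'a
  have "compactin (product_topology (\<lambda>_. euclidean) UNIV) (\<Pi>\<^sub>E i\<in>UNIV. B i)"
    by (subst compactin_PiE) (auto simp: B_def)
  then have "compact (\<Pi>\<^sub>E i\<in>UNIV. B i)"
    by (simp add: euclidean_product_topology)
  moreover have "closed {v. sqnorm I v \<le> R}"
    by (rule closed_Collect_le) (auto intro: continuous_on_sqnorm)
  ultimately have "compact ((\<Pi>\<^sub>E i\<in>UNIV. B i) \<inter> {v. sqnorm I v \<le> R})"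
    by (rule compact_Int_closed)
  moreover have "(\<Pi>\<^sub>E i\<in>UNIV. B i) \<inter> {v. sqnorm I v \<le> R} = {v \<in> supp_space I. sqnorm I v \<le> R}"
  proof -
    have "cmod (v i) \<le> sqrt R" if "i \<in> I" "sqnorm I v \<le> R" for v i
    proof -
      have "(cmod (v i))\<^sup>2 \<le> sqnorm I v"
        unfolding sqnorm_def by (rule member_le_sum[of i I "\<lambda>i. (cmod (v i))\<^sup>2"]) (use that assms in auto)
      then show ?thesis using that by (intro real_le_rsqrt) simp
    qed
    then show ?thesis by (fastforce simp: B_def supp_space_def PiE_iff split: if_splits)
  qed
  ultimately show ?thesis by simp
qed

lemma compact_sqnorm_sphere:
  assumes "finite I"
  shows "compact {v \<in> supp_space I. sqnorm I v = 1}"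
proof -
  have "closed {v. sqnorm I v = 1}"
    by (rule closed_Collect_eq) (auto intro: continuous_on_sqnorm)
  with compact_sqnorm_ball[OF assms, of 1]
  have "compact ({v \<in> supp_space I. sqnorm I v \<le> 1} \<inter> {v. sqnorm I v = 1})"
    by (rule compact_Int_closed)
  moreover have "{v \<in> supp_space I. sqnorm I v \<le> 1} \<inter> {v. sqnorm I v = 1} = {v \<in> supp_space I. sqnorm I v = 1}"
    by auto
  ultimately show ?thesis by simp
qed

lemma normalize_vector:
  assumes "finite I" "v \<in> supp_space I" "v i \<noteq> 0"
  obtains c w where "c > 0" "w \<in> supp_space I" "sqnorm I w = 1" "v = (\<lambda>i. complex_of_real c * w i)"
    "c\<^sup>2 = sqnorm I v"
proof
  let ?c = "sqrt (sqnorm I v)"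
  have pos: "sqnorm I v > 0" by (rule sqnorm_pos[OF assms])
  then show "?c > 0" by simp
  show "(\<lambda>i. complex_of_real (inverse ?c) * v i) \<in> supp_space I"
    by (rule supp_space_scale[OF assms(2)])
  show "sqnorm I (\<lambda>i. complex_of_real (inverse ?c) * v i) = 1"
    using pos unfolding sqnorm_scale by (simp add: norm_inverse power_inverse)
  show "v = (\<lambda>i. complex_of_real ?c * (complex_of_real (inverse ?c) * v i))"
    using pos by (simp add: fun_eq_iff)
  show "?c\<^sup>2 = sqnorm I v" using pos by simp
qed

lemma cmod_add_squared: "(cmod (z + w))\<^sup>2 = (cmod z)\<^sup>2 + 2 * Re (cnj z * w) + (cmod w)\<^sup>2"
  unfolding cmod_power2 by (simp add: power2_eq_square algebra_simps)

section \<open>Common zeros of fewer forms than unknowns\<close>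

lemma common_zero_of_forms:
  fixes f :: "'j \<Rightarrow> ('i \<Rightarrow> complex) \<Rightarrow> complex"
  assumes fin: "finite J" "finite I" "card J < card I"
    and poly: "\<And>j. j \<in> J \<Longrightarrow> polyfun (f j)"
    and deg: "\<And>j. j \<in> J \<Longrightarrow> d j \<ge> 1"
    and hom: "\<And>j c v. j \<in> J \<Longrightarrow> f j (\<lambda>i. c * v i) = c ^ d j * f j v"
  obtains v where "v \<in> supp_space I" "\<exists>i. v i \<noteq> 0" "\<And>j. j \<in> J \<Longrightarrow> f j v = 0"
proof (rule ccontr)
  assume "\<not> thesis"
  with that have nz: "\<exists>j\<in>J. f j v \<noteq> 0" if "v \<in> supp_space I" "v i \<noteq> 0" for v i
    using that by blast
  \<comment> \<open>Squaring makes all degrees at least 2, so that \<open>E\<close> outgrows \<open>sqnorm I\<close>.\<close>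
  define G where "G j v = f j v ^ 2" for j v
  define E where "E v = (\<Sum>j\<in>J. (cmod (G j v))\<^sup>2)" for v
  define \<psi> where "\<psi> v = sqnorm I v - E v" for v
  have polyG: "polyfun (G j)" if "j \<in> J" for j
    unfolding G_def[abs_def] by (rule polyfun_power[OF poly[OF that]])
  have contG: "continuous_on S (G j)" if "j \<in> J" for j S
    using polyfun_continuous[OF polyG[OF that]] continuous_on_subset by blast
  have contE: "continuous_on S E" for S
    unfolding E_def[abs_def] by (intro continuous_intros contG)
  have "I \<noteq> {}" using fin by auto
  then obtain i0 where "i0 \<in> I" by blast
  let ?S = "{v \<in> supp_space I. sqnorm I v = 1}"
  have "(\<lambda>i. if i = i0 then 1 else 0) \<in> ?S"
  proof -
    have "(\<Sum>i\<in>I. (cmod (if i = i0 then 1 else 0))\<^sup>2) = (\<Sum>i\<in>I. if i = i0 then 1 else (0::real))"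
      by (rule sum.cong) auto
    then show ?thesis using \<open>i0 \<in> I\<close> fin(2) by (auto simp: supp_space_def sqnorm_def)
  qed
  then have "?S \<noteq> {}" by blast
  \<comment> \<open>The minimum of \<open>E\<close> on the unit sphere is positive by
    \<open>nz\<close> and serves as the constant in the growth estimate.\<close>
  from continuous_attains_inf[OF compact_sqnorm_sphere[OF fin(2)] this contE]
  obtain u where u: "u \<in> ?S" and min: "\<And>v. v \<in> ?S \<Longrightarrow> E u \<le> E v" by blast
  have "E u > 0"
  proof -
    have "\<exists>i. u i \<noteq> 0"
    proof (rule ccontr)
      assume "\<nexists>i. u i \<noteq> 0"
      then have "sqnorm I u = 0" by (simp add: sqnorm_def)
      with u show False by simp
    qed
    then obtain j where "j \<in> J" "f j u \<noteq> 0" using nz u by blast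
    then show ?thesis using fin(1) unfolding E_def by (intro sum_pos2[of J j]) (auto simp: G_def)
  qed
  \<comment> \<open>\<open>G j\<close> has degree \<open>2 * d j\<close>, so its squared modulus
    scales by \<open>c ^ (4 * d j)\<close>, which is at least \<open>c ^ 4\<close> because
    \<open>c \<ge> 1\<close> and \<open>d j \<ge> 1\<close>.\<close>
  have growth: "E v \<ge> E u * (sqnorm I v)\<^sup>2" if v: "v \<in> supp_space I" "sqnorm I v \<ge> 1" for v
  proof -
    have "\<exists>i. v i \<noteq> 0"
    proof (rule ccontr)
      assume "\<nexists>i. v i \<noteq> 0"
      then have "sqnorm I v = 0" by (simp add: sqnorm_def)
      with v show False by simp
    qed
    then obtain i where "v i \<noteq> 0" by blast
    from normalize_vector[OF fin(2) v(1) this] obtain c w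
      where c: "c > 0" "w \<in> supp_space I" "sqnorm I w = 1" "v = (\<lambda>i. complex_of_real c * w i)"
        "c\<^sup>2 = sqnorm I v" .
    have "c \<ge> 1" using c(1,5) v(2) by (metis abs_of_pos one_le_power abs_le_square_iff power_one abs_one)
    have "c ^ 4 * (cmod (G j w))\<^sup>2 \<le> (cmod (G j v))\<^sup>2" if j: "j \<in> J" for j
    proof -
      have "(cmod (G j v))\<^sup>2 = c ^ (4 * d j) * (cmod (G j w))\<^sup>2"
        using c(1) unfolding G_def c(4) hom[OF j]
        by (simp add: norm_mult norm_power power_mult_distrib flip: power_mult)
      moreover have "c ^ 4 \<le> c ^ (4 * d j)"
        using \<open>c \<ge> 1\<close> deg[OF j] by (intro power_increasing) auto
      ultimately show ?thesis by (simp add: mult_right_mono)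
    qed
    then have "c ^ 4 * E w \<le> E v"
      unfolding E_def sum_distrib_left by (rule sum_mono)
    moreover have "c ^ 4 * E u \<le> c ^ 4 * E w"
      using min[of w] c by (intro mult_left_mono) auto
    moreover have "c ^ 4 = (sqnorm I v)\<^sup>2" unfolding c(5)[symmetric] by (simp flip: power_mult)
    ultimately show ?thesis by (simp add: mult.commute)
  qed
  \<comment> \<open>Outside this radius \<open>E\<close> exceeds \<open>sqnorm I\<close>, so
    \<open>\<psi>\<close> is at most 0, its value at the origin; a maximum on the ball is therefore
    global. The bound 1 keeps \<open>growth\<close> applicable.\<close>
  define R where "R = max 1 (inverse (E u))"
  let ?B = "{v \<in> supp_space I. sqnorm I v \<le> R}"
  have zero: "(\<lambda>_. 0) \<in> ?B" by (simp add: supp_space_def sqnorm_def R_def)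
  have cont\<psi>: "continuous_on ?B \<psi>"
    unfolding \<psi>_def[abs_def] by (intro continuous_intros contE continuous_on_sqnorm)
  have "?B \<noteq> {}" using zero by blast
  from continuous_attains_sup[OF compact_sqnorm_ball[OF fin(2)] this cont\<psi>]
  obtain x where x: "x \<in> ?B" and max: "\<And>v. v \<in> ?B \<Longrightarrow> \<psi> v \<le> \<psi> x" by blast
  have "E (\<lambda>_. 0) = 0"
  proof -
    have "f j (\<lambda>_. 0) = 0" if "j \<in> J" for j
      using hom[OF that, of 0 "\<lambda>_. 0"] deg[OF that] by (simp add: power_0_left)
    then show ?thesis by (simp add: E_def G_def)
  qed
  then have "\<psi> x \<ge> 0" using max[OF zero] by (simp add: \<psi>_def sqnorm_def)
  have gmax: "\<psi> v \<le> \<psi> x" if v: "v \<in> supp_space I" for v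
  proof (cases "sqnorm I v \<le> R")
    case False
    then have s: "sqnorm I v \<ge> 1" "inverse (E u) \<le> sqnorm I v" by (auto simp: R_def)
    then have "1 \<le> E u * sqnorm I v" using \<open>E u > 0\<close> by (simp add: field_simps)
    then have "sqnorm I v \<le> E u * (sqnorm I v)\<^sup>2"
      using s(1) mult_right_mono[of 1 "E u * sqnorm I v" "sqnorm I v"] by (simp add: power2_eq_square mult.assoc)
    then have "\<psi> v \<le> 0" using growth[OF v s(1)] by (simp add: \<psi>_def)
    then show ?thesis using \<open>\<psi> x \<ge> 0\<close> by simp
  qed (use max v in blast)
  have "\<exists>A. \<forall>j\<in>J. \<forall>v\<in>supp_space I.
    ((\<lambda>t. G j (\<lambda>i. x i + t * v i)) has_field_derivative (\<Sum>i\<in>I. A j i * v i)) (at 0)"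
  proof -
    have "\<forall>j\<in>J. \<exists>A. \<forall>v\<in>supp_space I.
      ((\<lambda>t. G j (\<lambda>i. x i + t * v i)) has_field_derivative (\<Sum>i\<in>I. A i * v i)) (at 0)"
    proof
      fix j assume "j \<in> J"
      from polyfun_gradient[OF polyG[OF this], of x] obtain A where
        "\<And>I v. finite I \<Longrightarrow> (\<And>i. i \<notin> I \<Longrightarrow> v i = 0) \<Longrightarrow>
          ((\<lambda>t. G j (\<lambda>i. x i + t * v i)) has_field_derivative (\<Sum>i\<in>I. A i * v i)) (at 0)" by blast
      then show "\<exists>A. \<forall>v\<in>supp_space I.
        ((\<lambda>t. G j (\<lambda>i. x i + t * v i)) has_field_derivative (\<Sum>i\<in>I. A i * v i)) (at 0)"
        using fin(2) by (auto simp: supp_space_def)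
    qed
    then show ?thesis by (rule bchoice)
  qed
  then obtain A where A: "\<And>j v. j \<in> J \<Longrightarrow> v \<in> supp_space I \<Longrightarrow>
    ((\<lambda>t. G j (\<lambda>i. x i + t * v i)) has_field_derivative (\<Sum>i\<in>I. A j i * v i)) (at 0)" by blast
  \<comment> \<open>This is where \<open>card J < card I\<close> enters: some nonzero direction
    kills all first derivatives of the \<open>G j\<close> at \<open>x\<close>.\<close>
  from underdetermined_linear_system[OF fin, of A] obtain v k
    where v: "v \<in> supp_space I" "v k \<noteq> 0" "\<And>j. j \<in> J \<Longrightarrow> (\<Sum>i\<in>I. A j i * v i) = 0"
    by (auto simp: supp_space_def)
  define \<delta> where "\<delta> j t = G j (\<lambda>i. x i + t * v i) - G j x" for j t
  \<comment> \<open>Expanding the squared moduli at \<open>x + t v\<close> by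
    \<open>cmod_add_squared\<close>, the cross terms are twice the real part of this function,
    holomorphic in \<open>t\<close> since the conjugated factors are constants.\<close>
  define h where "h t = (\<Sum>i\<in>I. cnj (x i) * (t * v i)) - (\<Sum>j\<in>J. cnj (G j x) * \<delta> j t)" for t
  have \<psi>_line: "\<psi> (\<lambda>i. x i + t * v i)
      = \<psi> x + 2 * Re (h t) + sqnorm I v * (cmod t)\<^sup>2 - (\<Sum>j\<in>J. (cmod (\<delta> j t))\<^sup>2)" for t
  proof -
    have "sqnorm I (\<lambda>i. x i + t * v i)
        = sqnorm I x + 2 * Re (\<Sum>i\<in>I. cnj (x i) * (t * v i)) + sqnorm I (\<lambda>i. t * v i)"
      unfolding sqnorm_def cmod_add_squared by (simp add: sum.distrib sum_distrib_left)
    moreover have "E (\<lambda>i. x i + t * v i)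
        = E x + 2 * Re (\<Sum>j\<in>J. cnj (G j x) * \<delta> j t) + (\<Sum>j\<in>J. (cmod (\<delta> j t))\<^sup>2)"
    proof -
      have "E (\<lambda>i. x i + t * v i) = (\<Sum>j\<in>J. (cmod (G j x + \<delta> j t))\<^sup>2)" by (simp add: E_def \<delta>_def)
      then show ?thesis
        unfolding cmod_add_squared by (simp add: E_def sum.distrib sum_distrib_left)
    qed
    ultimately show ?thesis by (simp add: \<psi>_def h_def sqnorm_scale mult.commute)
  qed
  have "\<exists>t. 2 * Re (h t) + sqnorm I v * (cmod t)\<^sup>2 - (\<Sum>j\<in>J. (cmod (\<delta> j t))\<^sup>2) > 2 * Re (h 0)"
  proof (rule second_order_increase[OF fin(1)])
    show "h holomorphic_on UNIV"
      unfolding h_def[abs_def] \<delta>_def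
      by (intro holomorphic_intros polyfun_line_holomorphic polyG)
    show "sqnorm I v > 0" by (rule sqnorm_pos[OF fin(2) v(1,2)])
    show "(\<delta> j has_field_derivative 0) (at 0)" if "j \<in> J" for j
      unfolding \<delta>_def[abs_def] using A[OF that v(1)] v(3)[OF that]
      by (auto intro!: derivative_eq_intros)
  qed (simp add: \<delta>_def)
  then obtain t where t: "2 * Re (h t) + sqnorm I v * (cmod t)\<^sup>2 - (\<Sum>j\<in>J. (cmod (\<delta> j t))\<^sup>2) > 2 * Re (h 0)" ..
  have "h 0 = 0" by (simp add: h_def \<delta>_def)
  moreover have "(\<lambda>i. x i + t * v i) \<in> supp_space I" using x v by (simp add: supp_space_def)
  ultimately show False using gmax[of "\<lambda>i. x i + t * v i"] t unfolding \<psi>_line by simp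
qed

section \<open>Discrete intersections of hypersurfaces\<close>

lemma homogeneous_poly_polyfun:
  assumes "homogeneous_poly n d f"
  shows "polyfun f"
proof -
  from assms obtain c where "f = (\<lambda>v. \<Sum>a\<in>exponents n d. c a * (\<Prod>i<n. v i ^ a i))"
    unfolding homogeneous_poly_def by blast
  then show ?thesis
    by (auto intro!: polyfun_sum polyfun_prod polyfun_power polyfun.intros)
qed

lemma homogeneous_poly_scale:
  assumes "homogeneous_poly n d f"
  shows "f (\<lambda>i. b * v i) = b ^ d * f v"
proof -
  from assms obtain c where f: "f = (\<lambda>v. \<Sum>a\<in>exponents n d. c a * (\<Prod>i<n. v i ^ a i))"
    unfolding homogeneous_poly_def by blast
  have "(\<Prod>i<n. (b * v i) ^ a i) = b ^ d * (\<Prod>i<n. v i ^ a i)" if "a \<in> exponents n d" for a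
    using that by (simp add: exponents_def power_mult_distrib prod.distrib flip: power_sum)
  then show ?thesis
    by (simp add: f sum_distrib_left mult_ac)
qed

lemma linear_form_avoiding_finite:
  fixes V :: "(nat \<Rightarrow> complex) set"
  assumes "finite I" "finite V" and V: "\<And>v. v \<in> V \<Longrightarrow> v \<in> supp_space I \<and> (\<exists>i. v i \<noteq> 0)"
  obtains a where "\<And>v. v \<in> V \<Longrightarrow> (\<Sum>i\<in>I. a i * v i) \<noteq> 0"
proof -
  \<comment> \<open>On the moment curve \<open>a i = z ^ i\<close> each \<open>v\<close> excludes only the finitely many roots of \<open>P v\<close>.\<close>
  define P where "P v = (\<Sum>i\<in>I. monom (v i) i)" for v :: "nat \<Rightarrow> complex"
  have "P v \<noteq> 0" if v: "v \<in> V" for v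
  proof
    assume "P v = 0"
    from V[OF v] obtain i where i: "v i \<noteq> 0" "i \<in> I" by (auto simp: supp_space_def)
    have "coeff (P v) i = v i"
      using i \<open>finite I\<close> by (simp add: P_def coeff_sum)
    with \<open>P v = 0\<close> i show False by simp
  qed
  then have "finite (\<Union>v\<in>V. {z. poly (P v) z = 0})"
    using \<open>finite V\<close> by (auto intro: poly_roots_finite)
  then obtain z where "z \<notin> (\<Union>v\<in>V. {z. poly (P v) z = 0})"
    using ex_new_if_finite infinite_UNIV_char_0 by blast
  then have "(\<Sum>i\<in>I. z ^ i * v i) \<noteq> 0" if "v \<in> V" for v
    using that by (auto simp: P_def poly_sum poly_monom mult.commute)
  then show ?thesis by (rule that)
qed

lemma mem_complex_line: "v \<in> complex_line v"
  unfolding complex_line_def by (rule image_eqI[of _ _ 1]) auto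

text \<open>Meant for \<open>I\<close> indexing the coordinates of a fixed component and
  \<open>J\<close> the hypersurfaces that need not contain it. The extra 1 in \<open>card\<close>
  leaves room for one linear form besides those of \<open>J\<close>.\<close>

lemma not_transverse_if_few_forms:
  assumes I: "I \<subseteq> {..<p + q}" and J: "J \<subseteq> {..<p + q - 1}" and card: "card J + 1 < card I"
    and hyp: "\<And>j. j \<in> J \<Longrightarrow> hypersurface p q (H j)"
    and vanish: "\<And>i v. i < p + q - 1 \<Longrightarrow> i \<notin> J \<Longrightarrow> v \<in> supp_space I \<Longrightarrow> v \<noteq> zerov \<Longrightarrow> complex_line v \<in> H i"
  shows "\<not> dimensionally_transverse p q H"
proof
  assume trans: "dimensionally_transverse p q H"
  define X where "X = proj_space p q \<inter> (\<Inter>i<p + q - 1. H i)"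
  have disc: "subtopology (proj_topology p q) X = discrete_topology X"
    using trans by (simp add: dimensionally_transverse_def X_def)
  have finI: "finite I" and finJ: "finite J"
    using I J finite_subset by blast+
  \<comment> \<open>Degree and form are packed into a pair so that one application of choice selects
    both.\<close>
  have "\<forall>j\<in>J. \<exists>df. fst df \<ge> 1 \<and> homogeneous_poly (p + q) (fst df) (snd df) \<and>
      H j = {l \<in> proj_space p q. \<forall>v\<in>l. snd df v = 0}"
    using hyp unfolding hypersurface_def by fastforce
  from bchoice[OF this] obtain df where df: "\<forall>j\<in>J. fst (df j) \<ge> 1 \<and> homogeneous_poly (p + q) (fst (df j)) (snd (df j)) \<and>
      H j = {l \<in> proj_space p q. \<forall>v\<in>l. snd (df j) v = 0}"
    by blast
  define d f where "d j = fst (df j)" and "f j = snd (df j)" for j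
  have d: "d j \<ge> 1" and f: "homogeneous_poly (p + q) (d j) (f j)"
    and H: "H j = {l \<in> proj_space p q. \<forall>v\<in>l. f j v = 0}" if "j \<in> J" for j
    using df that by (auto simp: d_def f_def)
  have rep: "v \<in> sigma_rep p q" if "v \<in> supp_space I" for v
    using that I by (auto simp: sigma_rep_def supp_space_def)
  have line_X: "complex_line v \<in> X"
    if v: "v \<in> supp_space I" "v \<noteq> zerov" "\<And>j. j \<in> J \<Longrightarrow> f j v = 0" for v
  proof -
    have proj: "complex_line v \<in> proj_space p q"
      unfolding proj_space_def using rep v by blast
    have "complex_line v \<in> H i" if "i < p + q - 1" for i
    proof (cases "i \<in> J")
      case True
      then show ?thesis
        using proj v(3)[OF True] homogeneous_poly_scale[OF f[OF True]]
        by (auto simp: H complex_line_def)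
    qed (use vanish that v in blast)
    with proj show ?thesis by (simp add: X_def)
  qed
  \<comment> \<open>Compactness is used upstairs, on the unit vectors over the common zeros, rather
    than in projective space.\<close>
  define S where "S = {v \<in> supp_space I. sqnorm I v = 1} \<inter> (\<Inter>j\<in>J. {v. f j v = 0})"
  have "closed {v. f j v = 0}" if "j \<in> J" for j
    by (rule closed_Collect_eq) (auto intro: polyfun_continuous homogeneous_poly_polyfun f that)
  then have "compact S"
    unfolding S_def by (intro compact_Int_closed compact_sqnorm_sphere finI closed_INT) auto
  have S_nz: "v \<noteq> zerov" if "v \<in> S" for v
    using that by (auto simp: S_def sqnorm_def zerov_def)
  \<comment> \<open>An open set isolating the line of \<open>v\<close> in \<open>X\<close> pulls
    back along the quotient map to a neighbourhood that meets \<open>S\<close> only in that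
    line.\<close>
  have "\<exists>T. open T \<and> v \<in> T \<and> S \<inter> T \<subseteq> complex_line v" if v: "v \<in> S" for v
  proof -
    have lX: "complex_line w \<in> X" if "w \<in> S" for w
      using line_X S_nz[OF that] that by (auto simp: S_def)
    have "openin (subtopology (proj_topology p q) X) {complex_line v}"
      unfolding disc using lX[OF v] by simp
    then obtain U where U: "openin (proj_topology p q) U" "{complex_line v} = U \<inter> X"
      unfolding openin_subtopology by blast
    from U(1) obtain T where T: "open T"
      "{w \<in> sigma_rep p q - {zerov}. complex_line w \<in> U} = (sigma_rep p q - {zerov}) \<inter> T"
      unfolding openin_proj_topology openin_open by blast
    have SU: "complex_line w \<in> U \<longleftrightarrow> w \<in> T" if "w \<in> S" for w
    proof -
      have "w \<in> sigma_rep p q - {zerov}"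
        using that rep S_nz[OF that] by (auto simp: S_def)
      then show ?thesis using T(2) by blast
    qed
    have "w \<in> complex_line v" if "w \<in> S" "w \<in> T" for w
      using SU[OF that(1)] that(2) lX[OF that(1)] U(2) mem_complex_line[of w] by auto
    moreover have "v \<in> T" using SU[OF v] U(2) by blast
    ultimately show ?thesis using T(1) by blast
  qed
  then obtain T where T: "\<And>v. v \<in> S \<Longrightarrow> open (T v)" "\<And>v. v \<in> S \<Longrightarrow> v \<in> T v"
    "\<And>v. v \<in> S \<Longrightarrow> S \<inter> T v \<subseteq> complex_line v"
    by metis
  have "S \<subseteq> (\<Union>v\<in>S. T v)" using T(2) by blast
  \<comment> \<open>Hence every point of \<open>S\<close> lies on one of the finitely many lines
    through \<open>D\<close>.\<close>
  from compactE_image[OF \<open>compact S\<close> T(1) this] obtain D where D: "D \<subseteq> S" "finite D" "S \<subseteq> (\<Union>v\<in>D. T v)"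
    by blast
  have "v \<in> supp_space I \<and> (\<exists>i. v i \<noteq> 0)" if "v \<in> D" for v
    using that D(1) S_nz[of v] by (auto simp: S_def zerov_def)
  from linear_form_avoiding_finite[OF finI D(2) this]
  obtain a where a: "\<And>v. v \<in> D \<Longrightarrow> (\<Sum>i\<in>I. a i * v i) \<noteq> 0" by blast
  define lf where "lf v = (\<Sum>i\<in>I. a i * v i)" for v
  have lf_scale: "lf (\<lambda>i. c * v i) = c * lf v" for c v
    by (simp add: lf_def sum_distrib_left mult_ac)
  \<comment> \<open>The index \<open>None\<close> stands for the linear form, of degree 1, and
    \<open>Some j\<close> for \<open>f j\<close>; altogether there are \<open>card J + 1\<close>
    forms.\<close>
  obtain w where w: "w \<in> supp_space I" "\<exists>i. w i \<noteq> 0"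
    "\<And>k. k \<in> insert None (Some ` J) \<Longrightarrow> case_option lf f k w = 0"
  proof (rule common_zero_of_forms[of "insert None (Some ` J)" I "case_option lf f" "case_option 1 d"])
    show "card (insert None (Some ` J)) < card I"
      using card finJ by (simp add: card_image)
    show "polyfun (case_option lf f k)" if "k \<in> insert None (Some ` J)" for k
      using that homogeneous_poly_polyfun[OF f] unfolding lf_def[abs_def]
      by (auto intro!: polyfun_sum polyfun.mult polyfun.const polyfun.coord)
  qed (use finI finJ d homogeneous_poly_scale[OF f] lf_scale in auto)
  from w(2) obtain i where i: "w i \<noteq> 0" ..
  from normalize_vector[OF finI w(1) i] obtain c u
    where c: "c > 0" "u \<in> supp_space I" "sqnorm I u = 1" "w = (\<lambda>i. complex_of_real c * u i)" .
  have "f j u = 0" if "j \<in> J" for j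
    using w(3)[of "Some j"] that c(1) homogeneous_poly_scale[OF f[OF that]] by (simp add: c(4))
  then have "u \<in> S" using c by (simp add: S_def)
  then obtain v where "v \<in> D" "u \<in> T v" using D by blast
  \<comment> \<open>The normalized zero is a multiple of some \<open>v\<close> in \<open>D\<close>;
    since \<open>lf\<close> vanishes at \<open>w\<close> but not at \<open>v\<close>, that multiple
    must be 0.\<close>
  then obtain b where b: "u = (\<lambda>i. b * v i)"
    using T(3)[of v] D(1) \<open>u \<in> S\<close> by (auto simp: complex_line_def)
  have "lf w = 0" using w(3)[of None] by simp
  then have "b = 0"
    using a[OF \<open>v \<in> D\<close>] c(1) unfolding c(4) b lf_scale by (simp add: lf_def)
  then show False using i unfolding c(4) b by simp
qed

section \<open>Sections over the fixed components\<close>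

text \<open>On a fixed component the generator acts on each line by \<open>\<epsilon>\<close>, so on the fibre of \<open>L\<close> by
  \<open>line_sign L * \<epsilon> powi line_degree L\<close>; when this is not 1, an equivariant section vanishes.\<close>

lemma equivariant_section_vanishes:
  assumes alg: "algebraic_section p q L s" and equi: "equivariant_section p q L s"
    and v: "v \<in> sigma_rep p q" "v \<noteq> zerov" and act: "act p v = (\<lambda>i. \<epsilon> * v i)" and "\<epsilon> \<noteq> 0"
    and sign: "line_sign L * \<epsilon> powi line_degree L \<noteq> 1"
  shows "complex_line v \<in> zero_locus p q s"
proof -
  let ?l = "complex_line v"
  have l: "?l \<in> proj_space p q" using v by (auto simp: proj_space_def)
  then have fib: "s ?l \<in> fibre L ?l" using alg by (simp add: algebraic_section_def)
  have act_line: "act p u = (\<lambda>i. \<epsilon> * u i)" if "u \<in> ?l" for u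
  proof -
    from that obtain c where u: "u = (\<lambda>i. c * v i)" by (auto simp: complex_line_def)
    have "act p u = (\<lambda>i. c * act p v i)" by (auto simp: act_def u)
    then show ?thesis by (simp add: u act mult_ac)
  qed
  have scale_mem: "(\<lambda>i. c * u i) \<in> ?l" if u: "u \<in> ?l" for c u
  proof -
    from u obtain b where "u = (\<lambda>i. b * v i)" by (auto simp: complex_line_def)
    then have "(\<lambda>i. c * u i) = (\<lambda>i. (c * b) * v i)" by (simp add: mult.assoc)
    then show ?thesis unfolding complex_line_def by blast
  qed
  have "act p ` ?l = ?l"
  proof
    show "act p ` ?l \<subseteq> ?l" using act_line scale_mem by auto
    \<comment> \<open>The reverse inclusion follows because \<open>act p\<close> is an
      involution.\<close>
    then show "?l \<subseteq> act p ` ?l" by (metis act_act image_eqI image_subset_iff subsetI)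
  qed
  then have "s ?l = bundle_act p L (s ?l)"
    using equi l by (metis equivariant_section_def)
  then have eq: "s ?l u = line_sign L * s ?l (act p u)" for u
    unfolding bundle_act_def by (rule fun_cong)
  have "s ?l u = 0" for u
  proof (cases "u \<in> ?l - {zerov}")
    case True
    then have "s ?l (act p u) = \<epsilon> powi line_degree L * s ?l u"
      using fib act_line[of u] \<open>\<epsilon> \<noteq> 0\<close> by (simp add: fibre_def)
    then have "(1 - line_sign L * \<epsilon> powi line_degree L) * s ?l u = 0"
      using eq[of u] by (simp add: algebra_simps)
    then show ?thesis using sign by simp
  qed (use fib in \<open>simp add: fibre_def\<close>)
  then show ?thesis using l by (auto simp: zero_locus_def)
qed

lemma num_type_add:
  assumes "t \<noteq> t'"
  shows "num_type p q L t + num_type p q L t' = card {i. i < p + q - 1 \<and> bundle_type_of (L i) \<in> {t, t'}}"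
proof -
  have "{i. i < p + q - 1 \<and> bundle_type_of (L i) \<in> {t, t'}}
      = {i. i < p + q - 1 \<and> bundle_type_of (L i) = t} \<union> {i. i < p + q - 1 \<and> bundle_type_of (L i) = t'}"
    by auto
  then show ?thesis
    using assms unfolding num_type_def by (subst card_Un_disjoint[symmetric]) auto
qed

theorem proposition7p1:
  fixes p q :: nat
    and L :: "nat \<Rightarrow> line_bundle"
    and s :: "nat \<Rightarrow> bundle_section"
  assumes "p + q \<ge> 1"
    and "\<And>i. i < p + q - 1 \<Longrightarrow> algebraic_section p q (L i) (s i)"
    and "\<And>i. i < p + q - 1 \<Longrightarrow> equivariant_section p q (L i) (s i)"
    and "\<And>i. i < p + q - 1 \<Longrightarrow> hypersurface p q (zero_locus p q (s i))"
    and "\<And>i. i < p + q - 1 \<Longrightarrow> act_invariant p (zero_locus p q (s i))"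
    and "dimensionally_transverse p q (\<lambda>i. zero_locus p q (s i))"
  shows "alpha p q L \<ge> 0 \<and> beta p q L \<ge> 0"
proof -
  \<comment> \<open>Both fixed components are handled at once: \<open>I\<close> indexes the
    coordinates of one, \<open>\<epsilon>\<close> is the scalar by which the generator acts there,
    and \<open>{t, t'}\<close> are the types whose sections need not vanish on it.\<close>
  have bound: "card I \<le> num_type p q L t + num_type p q L t' + 1"
    if "t \<noteq> t'" and I: "I \<subseteq> {..<p + q}" and "\<epsilon> \<noteq> 0"
      and act: "\<And>v. v \<in> supp_space I \<Longrightarrow> act p v = (\<lambda>i. \<epsilon> * v i)"
      and sign: "\<And>i. bundle_type_of (L i) \<notin> {t, t'} \<Longrightarrow> line_sign (L i) * \<epsilon> powi line_degree (L i) \<noteq> 1"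
    for I t t' \<epsilon>
  proof (rule ccontr)
    define J where "J = {i. i < p + q - 1 \<and> bundle_type_of (L i) \<in> {t, t'}}"
    assume "\<not> ?thesis"
    then have "card J + 1 < card I" by (simp add: num_type_add[OF \<open>t \<noteq> t'\<close>] J_def)
    have "\<not> dimensionally_transverse p q (\<lambda>i. zero_locus p q (s i))"
    proof (rule not_transverse_if_few_forms[OF I _ \<open>card J + 1 < card I\<close>])
      fix i v
      assume i: "i < p + q - 1" "i \<notin> J" and v: "v \<in> supp_space I" "v \<noteq> zerov"
      have "v \<in> sigma_rep p q" using v I by (auto simp: sigma_rep_def supp_space_def)
      then show "complex_line v \<in> zero_locus p q (s i)"
        by (rule equivariant_section_vanishes[OF assms(2,3)[OF i(1)] _ v(2) act[OF v(1)] \<open>\<epsilon> \<noteq> 0\<close> sign])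
           (use i in \<open>auto simp: J_def\<close>)
    qed (use assms(4) in \<open>auto simp: J_def\<close>)
    with assms(6) show False by contradiction
  qed
  have "card {..<p} \<le> num_type p q L TypeI + num_type p q L TypeII + 1"
  proof (rule bound)
    show "act p v = (\<lambda>i. 1 * v i)" if "v \<in> supp_space {..<p}" for v
      using that by (auto simp: act_def supp_space_def)
    \<comment> \<open>For \<open>\<epsilon> = 1\<close> only the sign of the bundle matters, and it
      is -1 for types III and IV.\<close>
    show "line_sign (L i) * 1 powi line_degree (L i) \<noteq> 1" if "bundle_type_of (L i) \<notin> {TypeI, TypeII}" for i
      using that by (cases "L i") (auto split: if_splits)
  qed auto
  moreover have "card {p..<p + q} \<le> num_type p q L TypeII + num_type p q L TypeIII + 1"
  proof (rule bound)
    show "act p v = (\<lambda>i. - 1 * v i)" if "v \<in> supp_space {p..<p + q}" for v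
      using that by (auto simp: act_def supp_space_def fun_eq_iff)
    \<comment> \<open>For \<open>\<epsilon> = - 1\<close> the parity of the degree contributes a
      further sign; the product is -1 for odd \<open>Oline\<close> and even \<open>ChiOline\<close>,
      that is, types I and IV.\<close>
    show "line_sign (L i) * (- 1) powi line_degree (L i) \<noteq> 1" if "bundle_type_of (L i) \<notin> {TypeII, TypeIII}" for i
      using that by (cases "L i") (auto simp: power_int_minus_left split: if_splits)
  qed auto
  ultimately show ?thesis by (simp add: alpha_def beta_def)
qed

end
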